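(* Let $n$ be a positive integer and let $A=A_s+A_d\epsilon$ be an $n\times n$ dual number matrix, where $A_s$ is a real irreducible nonnegative matrix and $A_d$ is a real matrix. Let $\lambda=\lambda_s+\lambda_d\epsilon$ be the Perron-Frobenius eigenvalue of $A$. Then for any $n$-dimensional positive dual number vector $\mathbf{x}$, we have $$\min_i\frac{(A\mathbf{x})_i}{x_i}\le\lambda\le\max_i\frac{(A\mathbf{x})_i}{x_i}.$$ Furthermore, $$\max_{\mathbf{x}>\mathbf{0}}\min_i\frac{(A\mathbf{x})_i}{x_i}=\lambda=\min_{\mathbf{x}>\mathbf{0}}\max_i\frac{(A\mathbf{x})_i}{x_i},$$ where $\mathbf{x}$ ranges over the $n$-dimensional positive dual number vectors.
   Context: A dual number is $a=a_s+a_d\epsilon$ with $a_s,a_d\in\mathbb{R}$ (standard part, dual part), where $\epsilon\neq0$, $\epsilon^2=0$; $a+b=(a_s+b_s)+(a_d+b_d)\epsilon$, $ab=a_sb_s+(a_sb_d+a_db_s)\epsilon$, and if $b_s\ne0$ then $\frac{a}{b}=\frac{a_s}{b_s}+\left(\frac{a_d}{b_s}-\frac{a_s}{b_s}\frac{b_d}{b_s}\right)\epsilon$. Dual numbers are totally ordered by: $a>b$ if $a_s>b_s$, or $a_s=b_s$ and $a_d>b_d$; all inequalities, minima and maxima between dual numbers use this order. A dual number vector is called positive (written $\mathbf{x}>\mathbf{0}$) if its standard part is entrywise positive. A dual complex number (same definition with complex parts) $\lambda$ is an eigenvalue of $A$ with eigenvector $\mathbf{x}=\mathbf{x}_s+\mathbf{x}_d\epsilon$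 if $A\mathbf{x}=\lambda\mathbf{x}$ and $\mathbf{x}_s\ne\mathbf{0}$. When $A_s$ is irreducible nonnegative, the Perron-Frobenius eigenvalue of $A$ is the unique eigenvalue $\lambda=\lambda_s+\lambda_d\epsilon$ of $A$ whose standard part $\lambda_s$ is the spectral radius of $A_s$; it is a dual number, with $\lambda_d=\frac{\mathbf{y}_s^\top A_d\mathbf{x}_s}{\mathbf{y}_s^\top\mathbf{x}_s}$, where $\mathbf{x}_s,\mathbf{y}_s$ are entrywise positive real eigenvectors of $A_s$ and $A_s^\top$ for $\lambda_s$. Convention: the $1\times1$ zero matrix is not regarded as irreducible. *)

theory Defs
  imports
    "Jordan_Normal_Form.Spectral_Radius"
    "HOL-Combinatorics.Permutations"
begin

section \<open>Dual numbers\<close>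

text \<open>\<open>Dual a b\<close> is the dual number \<open>a + b \<epsilon>\<close>; over \<open>real\<close> these are the dual numbers, over
  \<open>complex\<close> the dual complex numbers.\<close>

datatype 'a dual_num = Dual (std_part: 'a) (dual_part: 'a)

instantiation dual_num :: (comm_ring_1) comm_ring_1
begin

definition "0 = Dual 0 0"
definition "1 = Dual 1 0"
definition "a + b = Dual (std_part a + std_part b) (dual_part a + dual_part b)"
definition "- a = Dual (- std_part a) (- dual_part a)"
definition "a - b = Dual (std_part a - std_part b) (dual_part a - dual_part b)"
definition "a * b =
  Dual (std_part a * std_part b) (std_part a * dual_part b + dual_part a * std_part b)"

instance
  by standard
    (auto simp: zero_dual_num_def one_dual_num_def plus_dual_num_def uminus_dual_num_def
      minus_dual_num_def times_dual_num_def algebra_simps)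

end

text \<open>The quotient below is the intended one for \<open>std_part b \<noteq> 0\<close>; otherwise it has a dummy value,
  inherited from division by zero in the underlying field. The type class that provides the
  notation \<open>a / b\<close> also requires a constant \<open>inverse\<close>, which is the case \<open>1 / b\<close>.\<close>

instantiation dual_num :: (field) inverse
begin

definition "a div b = Dual (std_part a / std_part b)
  (dual_part a / std_part b - std_part a / std_part b * (dual_part b / std_part b))"
definition "inverse b = (1 :: 'a :: field dual_num) div b"

instance ..

end

instantiation dual_num :: (linorder) linorder
begin

definition
  "b < a \<longleftrightarrow> std_part a > std_part b \<or> (std_part a = std_part b \<and> dual_part a > dual_part b)"

definition
  "b \<le> a \<longleftrightarrow> b < a \<or> b = (a :: 'a :: linorder dual_num)"

instance
proof
  fix x y :: "'a dual_num"
  show "x \<le> y \<or> y \<le> x"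
    by (cases x; cases y) (auto simp: less_dual_num_def less_eq_dual_num_def)
qed (auto simp: less_dual_num_def less_eq_dual_num_def)

end

definition positive_dual_vec :: "real dual_num vec \<Rightarrow> bool" where
  "positive_dual_vec x \<longleftrightarrow> (\<forall>i < dim_vec x. std_part (x $ i) > 0)"


section \<open>Irreducible nonnegative matrices\<close>

definition nonnegative_mat :: "real mat \<Rightarrow> bool" where
  "nonnegative_mat A \<longleftrightarrow> (\<forall>i < dim_row A. \<forall>j < dim_col A. A $$ (i, j) \<ge> 0)"

text \<open>A square matrix \<open>A\<close> is reducible if \<open>P\<^sup>T A P\<close> is block upper triangular, with square nonempty
  diagonal blocks, for some permutation matrix \<open>P\<close>; if \<open>P\<close> is the matrix of the permutation \<open>p\<close>,
  then \<open>P\<^sup>T A P\<close> has the entry \<open>A $$ (p i, p j)\<close> at position \<open>(i, j)\<close>. The \<open>1 \<times> 1\<close> zero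
  matrix is reducible by convention.\<close>

definition reducible_mat :: "'a :: zero mat \<Rightarrow> bool" where
  "reducible_mat A \<longleftrightarrow>
     (let n = dim_row A in
       A = 0\<^sub>m 1 1 \<or>
       (\<exists>p r B C D. p permutes {..<n} \<and> 0 < r \<and> r < n \<and>
          B \<in> carrier_mat r r \<and> C \<in> carrier_mat r (n - r) \<and> D \<in> carrier_mat (n - r) (n - r) \<and>
          mat n n (\<lambda>(i, j). A $$ (p i, p j)) = four_block_mat B C (0\<^sub>m (n - r) r) D))"

definition irreducible_mat :: "'a :: zero mat \<Rightarrow> bool" where
  "irreducible_mat A \<longleftrightarrow> square_mat A \<and> \<not> reducible_mat A"


section \<open>Eigenvalues of dual number matrices\<close>

text \<open>This differs from the notion \<open>eigenvector\<close> for matrices over a commutative ring: the standard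
  part of the eigenvector, and not merely the eigenvector itself, has to be nonzero.\<close>

definition dual_eigenvector ::
    "complex dual_num mat \<Rightarrow> complex dual_num vec \<Rightarrow> complex dual_num \<Rightarrow> bool" where
  "dual_eigenvector A x lam \<longleftrightarrow>
     x \<in> carrier_vec (dim_row A) \<and> map_vec std_part x \<noteq> 0\<^sub>v (dim_row A) \<and> A *\<^sub>v x = lam \<cdot>\<^sub>v x"

definition dual_eigenvalue :: "complex dual_num mat \<Rightarrow> complex dual_num \<Rightarrow> bool" where
  "dual_eigenvalue A lam \<longleftrightarrow> (\<exists>x. dual_eigenvector A x lam)"

abbreviation complex_of_dual :: "real dual_num \<Rightarrow> complex dual_num" where
  "complex_of_dual \<equiv> map_dual_num complex_of_real"

text \<open>Eigenvalues are sought, and are unique, among the dual complex numbers, but the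
  Perron-Frobenius eigenvalue is a dual number.\<close>

definition perron_frobenius_eigenvalue :: "real dual_num mat \<Rightarrow> real dual_num" where
  "perron_frobenius_eigenvalue A =
     (THE lam. {\<mu>. dual_eigenvalue (map_mat complex_of_dual A) \<mu> \<and>
                 std_part \<mu> = complex_of_real
                   (spectral_radius (map_mat complex_of_real (map_mat std_part A)))}
             = {complex_of_dual lam})"


section \<open>Attained extrema\<close>

text \<open>The operators \<open>Max\<close> and \<open>Min\<close> are only meaningful for finite sets.\<close>

definition is_maximum :: "'a :: order set \<Rightarrow> 'a \<Rightarrow> bool" where
  "is_maximum S m \<longleftrightarrow> m \<in> S \<and> (\<forall>s \<in> S. s \<le> m)"

definition is_minimum :: "'a :: order set \<Rightarrow> 'a \<Rightarrow> bool" where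
  "is_minimum S m \<longleftrightarrow> m \<in> S \<and> (\<forall>s \<in> S. m \<le> s)"

end

theory Submission
  imports Defs
begin

text \<open>Write \<open>B\<close> and \<open>D\<close> for the standard and the dual part of \<open>A\<close>. Everything rests on the
  Perron-Frobenius theory of \<open>B\<close>: its spectral radius \<open>\<rho>\<close> has a right eigenvector \<open>x > 0\<close> and a
  left eigenvector \<open>y > 0\<close>, and the right eigenspace is spanned by \<open>x\<close>
  (\<open>perron_vector\<close>, \<open>left_perron_vector\<close>, \<open>complex_eigenvector_unique\<close>).

  A dual vector \<open>u + v \<epsilon>\<close> is an eigenvector for \<open>\<rho> + \<mu> \<epsilon>\<close> iff \<open>B u = \<rho> u\<close>, \<open>u \<noteq> 0\<close> and
  \<open>B v + D u = \<rho> v + \<mu> u\<close>. Here \<open>u\<close> is a multiple of \<open>x\<close>, and pairing the second equation with \<open>y\<close>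
  removes \<open>v\<close> and leaves \<open>\<mu> = y\<^sup>T D x / y\<^sup>T x\<close>. Conversely, for this \<open>\<mu>\<close> the vector
  \<open>\<mu> x - D x\<close> is orthogonal to \<open>y\<close>, hence in the range of \<open>B - \<rho>\<close> (\<open>fredholm_alternative\<close>), so
  that some real \<open>v\<close> completes \<open>x\<close> to an eigenvector. Therefore \<open>\<lambda> = \<rho> + \<mu> \<epsilon>\<close>
  (\<open>perron_frobenius_eigenvalue_eq\<close>), and \<open>x + v \<epsilon>\<close> is a positive dual vector all of whose quotients
  equal \<open>\<lambda>\<close>: both extrema are attained there.

  For the bounds, let \<open>z + w \<epsilon>\<close> be positive and suppose that all its quotients exceed \<open>\<lambda>\<close>. Then
  \<open>B z \<ge> \<rho> z\<close>; as \<open>y > 0\<close> annihilates \<open>B z - \<rho> z\<close>, equality holds and \<open>z\<close> is a multiple of \<open>x\<close>. Now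
  the dual parts must be strictly ordered, \<open>B w + D z > \<rho> w + \<mu> z\<close> entrywise, but both sides have
  the same product with \<open>y\<close>. The case of all quotients below \<open>\<lambda>\<close> is the same with the signs reversed
  (\<open>no_uniformly_strict_bound\<close>).\<close>

section \<open>Growth of nonnegative matrices\<close>

text \<open>All uses of a left eigenvector below go through this exchange of summations: it evaluates
  \<open>Y\<^sup>T M v\<close>, over the reals as well as over the complex numbers.\<close>

lemma left_eigen_sum:
  fixes M :: "nat \<Rightarrow> nat \<Rightarrow> 'a :: comm_ring_1"
  assumes "\<And>j. j < n \<Longrightarrow> (\<Sum>i<n. M i j * Y i) = r * Y j"
  shows "(\<Sum>i<n. Y i * (\<Sum>j<n. M i j * v j)) = r * (\<Sum>j<n. Y j * v j)"
proof -
  have "(\<Sum>i<n. Y i * (\<Sum>j<n. M i j * v j)) = (\<Sum>i<n. \<Sum>j<n. M i j * Y i * v j)"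
    by (simp add: sum_distrib_left mult_ac)
  also have "\<dots> = (\<Sum>j<n. (\<Sum>i<n. M i j * Y i) * v j)"
    by (subst sum.swap) (simp add: sum_distrib_right)
  also have "\<dots> = r * (\<Sum>j<n. Y j * v j)"
    using assms by (simp add: sum_distrib_left mult_ac)
  finally show ?thesis .
qed

text \<open>If \<open>B z \<ge> t z\<close> with \<open>z > 0\<close>, then \<open>B\<^sup>k z \<ge> t\<^sup>k z\<close>. For \<open>r\<close> strictly between the spectral
  radius and \<open>t\<close>, the powers of \<open>B / r\<close> would be bounded, since that matrix has spectral radius less
  than 1, and yet grow at least like \<open>(t / r)\<^sup>k\<close>.\<close>

lemma growth_le_spectral_radius:
  fixes n :: nat and B :: "nat \<Rightarrow> nat \<Rightarrow> real" and z :: "nat \<Rightarrow> real"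
  defines "C \<equiv> mat n n (\<lambda>(i, j). complex_of_real (B i j))"
  assumes n: "n > 0"
    and nonneg: "\<And>i j. i < n \<Longrightarrow> j < n \<Longrightarrow> 0 \<le> B i j"
    and z: "\<And>i. i < n \<Longrightarrow> 0 < z i"
    and t: "\<And>i. i < n \<Longrightarrow> t * z i \<le> (\<Sum>j<n. B i j * z j)"
  shows "t \<le> spectral_radius C"
proof (rule ccontr)
  assume "\<not> t \<le> spectral_radius C"
  have C: "C \<in> carrier_mat n n" by (simp add: C_def)
  have rho0: "0 \<le> spectral_radius C"
    using spectral_radius_mem_max(1)[OF C n] by auto
  obtain r where r: "spectral_radius C < r" "r < t"
    using \<open>\<not> t \<le> spectral_radius C\<close> dense[of "spectral_radius C" t] by auto
  have r0: "0 < r" using rho0 r by simp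
  define R where "R = mat n n (\<lambda>(i, j). B i j / r)"
  define f where "f w i = (\<Sum>j<n. B i j / r * w j)" for w :: "nat \<Rightarrow> real" and i
  define CR where "CR = map_mat complex_of_real R"
  have R: "R \<in> carrier_mat n n" by (simp add: R_def)
  have CR: "CR \<in> carrier_mat n n" by (simp add: CR_def R_def)
  have CR_C: "C = complex_of_real r \<cdot>\<^sub>m CR"
    using r0 by (auto simp: C_def CR_def R_def)
  have "spectral_radius CR < 1"
  proof -
    obtain k where k: "eigenvalue CR k" "spectral_radius CR = norm k"
      using spectral_radius_mem_max(1)[OF CR n] by (auto simp: spectrum_def)
    obtain v where v: "v \<in> carrier_vec n" "v \<noteq> 0\<^sub>v n" "CR *\<^sub>v v = k \<cdot>\<^sub>v v"
      using k(1) CR by (auto simp: eigenvalue_def eigenvector_def)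
    have "C *\<^sub>v v = (r * k) \<cdot>\<^sub>v v"
    proof -
      have "C *\<^sub>v v = complex_of_real r \<cdot>\<^sub>v (CR *\<^sub>v v)"
        unfolding CR_C using v(1) CR by (intro eq_vecI) (auto simp: scalar_prod_def sum_distrib_left mult_ac)
      then show ?thesis by (simp add: v(3) smult_smult_assoc)
    qed
    then have "eigenvalue C (r * k)"
      using v C unfolding eigenvalue_def eigenvector_def by auto
    then have "norm (r * k) \<le> spectral_radius C"
      by (intro spectral_radius_mem_max(2)[OF C n]) (auto simp: spectrum_def)
    then have "r * norm k \<le> spectral_radius C"
      using r0 by (simp add: norm_mult)
    then have "r * norm k < r * 1" using r by linarith
    then show ?thesis using k(2) mult_less_cancel_left_pos[OF r0] by metis
  qed
  then obtain c where c: "\<And>k. norm_bound (CR ^\<^sub>m k) c"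
    using spectral_radius_jnf_norm_bound_less_1_upper_triangular[OF CR] by blast
  have Rk: "R ^\<^sub>m k \<in> carrier_mat n n" for k using R by simp
  have bound: "\<bar>(R ^\<^sub>m k) $$ (i, j)\<bar> \<le> c" if "i < n" "j < n" for i j k
  proof -
    have "CR ^\<^sub>m k = map_mat complex_of_real (R ^\<^sub>m k)"
      unfolding CR_def by (rule of_real_hom.mat_hom_pow[OF R, symmetric])
    then show ?thesis
      using c[of k] that carrier_matD[OF Rk[of k]] unfolding norm_bound_def
      by (simp del: pow_mat_dim)
  qed
  have grow: "s * (t / r) ^ k * z i \<le> ((R ^\<^sub>m k) *\<^sub>v vec n w) $ i"
    if "0 \<le> s" "\<And>i. i < n \<Longrightarrow> s * z i \<le> w i" "i < n" for s w k i
    using that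
  proof (induction k arbitrary: s w)
    case 0
    then show ?case using R by simp
  next
    case (Suc k)
    have step: "s * (t / r) * z i \<le> f w i" if "i < n" for i
    proof -
      have "s * (t / r) * z i = s / r * (t * z i)" by simp
      also have "\<dots> \<le> s / r * (\<Sum>j<n. B i j * z j)"
        using t[OF that] Suc.prems(1) r0 by (intro mult_left_mono) auto
      also have "\<dots> = (\<Sum>j<n. B i j / r * (s * z j))"
        by (simp add: sum_distrib_left mult_ac)
      also have "\<dots> \<le> f w i"
        unfolding f_def using nonneg that r0 Suc.prems(2)
        by (intro sum_mono mult_left_mono) auto
      finally show ?thesis .
    qed
    have "R *\<^sub>v vec n w = vec n (f w)"
      by (auto simp: R_def f_def scalar_prod_def lessThan_atLeast0)
    then have pow: "(R ^\<^sub>m Suc k) *\<^sub>v vec n w = (R ^\<^sub>m k) *\<^sub>v vec n (f w)"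
      using Rk[of k] R by (simp add: assoc_mult_mat_vec[of _ n n _ n])
    have "0 \<le> s * (t / r)" using Suc.prems(1) r r0 by simp
    then have "s * (t / r) * (t / r) ^ k * z i \<le> ((R ^\<^sub>m k) *\<^sub>v vec n (f w)) $ i"
      by (rule Suc.IH[OF _ step Suc.prems(3)])
    then show ?case unfolding pow power_Suc by (simp only: mult.assoc)
  qed
  have "(t / r) ^ k * z 0 \<le> c * (\<Sum>j<n. z j)" for k
  proof -
    have "(t / r) ^ k * z 0 \<le> ((R ^\<^sub>m k) *\<^sub>v vec n z) $ 0"
      using grow[of 1 z 0 k] n by simp
    also have "\<dots> = (\<Sum>j<n. (R ^\<^sub>m k) $$ (0, j) * z j)"
      using carrier_matD[OF Rk[of k]] n
      by (simp add: scalar_prod_def lessThan_atLeast0 del: pow_mat_dim)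
    also have "\<dots> \<le> (\<Sum>j<n. c * z j)"
      using bound[OF n] z by (intro sum_mono mult_right_mono) (auto intro: less_imp_le abs_le_D1)
    finally show ?thesis by (simp add: sum_distrib_left)
  qed
  then have "(t / r) ^ k \<le> c * (\<Sum>j<n. z j) / z 0" for k
    using z[OF n] by (simp add: pos_le_divide_eq)
  moreover have "1 < t / r" using r r0 by simp
  ultimately show False
    by (meson real_arch_pow not_less)
qed

section \<open>Perron-Frobenius theory of an irreducible nonnegative matrix\<close>

text \<open>Vectors and matrices are functions here, of which only the values at indices below \<open>n\<close>
  matter; this avoids carrier conditions. Irreducibility is stated through invariant coordinate
  subspaces: the span of the unit vectors with index in \<open>S\<close> is invariant under \<open>B\<close> only if it is
  trivial. Unlike the permutation form, this passes to the transposed matrix by taking complements.\<close>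

locale irreducible_nonneg =
  fixes n :: nat and B :: "nat \<Rightarrow> nat \<Rightarrow> real"
  assumes dim_pos: "n > 0"
    and nonneg: "\<And>i j. i < n \<Longrightarrow> j < n \<Longrightarrow> 0 \<le> B i j"
    and irred: "\<And>S. S \<subseteq> {..<n} \<Longrightarrow> S \<noteq> {} \<Longrightarrow>
                  (\<And>i j. i \<in> {..<n} - S \<Longrightarrow> j \<in> S \<Longrightarrow> B i j = 0) \<Longrightarrow> S = {..<n}"
begin

definition app :: "(nat \<Rightarrow> real) \<Rightarrow> nat \<Rightarrow> real" where
  "app x i = (\<Sum>j<n. B i j * x j)"

definition rho :: real where
  "rho = spectral_radius (mat n n (\<lambda>(i, j). complex_of_real (B i j)))"

lemma app_nonneg: "(\<And>i. i < n \<Longrightarrow> 0 \<le> x i) \<Longrightarrow> i < n \<Longrightarrow> 0 \<le> app x i"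
  unfolding app_def by (intro sum_nonneg mult_nonneg_nonneg nonneg) auto

lemma app_add: "app (\<lambda>i. x i + y i) i = app x i + app y i"
  by (simp add: app_def algebra_simps sum.distrib)

lemma app_diff: "app (\<lambda>i. x i - y i) i = app x i - app y i"
  by (simp add: app_def algebra_simps sum_subtractf)

lemma app_scale: "app (\<lambda>i. c * x i) i = c * app x i"
  by (simp add: app_def algebra_simps sum_distrib_left)

text \<open>This is how irreducibility enters: if \<open>B v\<close> vanished wherever \<open>v\<close> does, the support of \<open>v\<close>
  would be an invariant set of indices.\<close>

lemma support_grows:
  assumes v: "\<And>i. i < n \<Longrightarrow> 0 \<le> v i" and nz: "\<exists>i<n. v i \<noteq> 0" and z: "\<exists>i<n. v i = 0"
  shows "\<exists>i<n. v i = 0 \<and> 0 < app v i"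
proof (rule ccontr)
  assume *: "\<not> ?thesis"
  define S where "S = {i. i < n \<and> v i \<noteq> 0}"
  have "S = {..<n}"
  proof (rule irred)
    show "S \<subseteq> {..<n}" "S \<noteq> {}" using nz by (auto simp: S_def)
    fix i j assume i: "i \<in> {..<n} - S" and j: "j \<in> S"
    have "app v i = 0"
      using * i app_nonneg[of v i] v by (force simp: S_def)
    then have "\<forall>j\<in>{..<n}. B i j * v j = 0"
      unfolding app_def using i v nonneg by (subst (asm) sum_nonneg_eq_0_iff) auto
    then show "B i j = 0" using j by (auto simp: S_def)
  qed
  then show False using z by (auto simp: S_def)
qed

lemma subinvariant_positive:
  assumes "\<And>i. i < n \<Longrightarrow> 0 \<le> x i" "\<exists>i<n. x i \<noteq> 0" "\<And>i. i < n \<Longrightarrow> app x i \<le> k * x i" "i < n"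
  shows "0 < x i"
proof (rule ccontr)
  assume "\<not> 0 < x i"
  then have "\<exists>i<n. x i = 0" using assms(1,4) by force
  then obtain i where "i < n" "x i = 0" "0 < app x i"
    using support_grows[of x] assms(1,2) by blast
  then show False using assms(3)[of i] by simp
qed

text \<open>Replacing \<open>z\<close> by \<open>(I + B) z\<close> replaces the defect \<open>B z - t z\<close> by \<open>(I + B) (B z - t z)\<close>, whose
  support is strictly larger until it is everything. This replaces the usual appeal to
  \<open>(I + B)\<^bsup>n-1\<^esup> > 0\<close>.\<close>

lemma strict_superinvariant:
  assumes "\<And>i. i < n \<Longrightarrow> 0 \<le> z i" "\<And>i. i < n \<Longrightarrow> t * z i \<le> app z i" "\<exists>i<n. app z i \<noteq> t * z i"
    "0 \<le> t"
  shows "\<exists>w. \<forall>i<n. 0 < w i \<and> t * w i < app w i"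
  using assms(1-3)
proof (induction "card {i. i < n \<and> app z i = t * z i}" arbitrary: z rule: less_induct)
  case less
  define d where "d = (\<lambda>i. app z i - t * z i)"
  define z' where "z' = (\<lambda>i. z i + app z i)"
  have d: "0 \<le> d i" if "i < n" for i using less.prems(2)[OF that] by (simp add: d_def)
  have d_z': "app z' i - t * z' i = d i + app d i" for i
    by (simp add: d_def z'_def app_add app_diff app_scale algebra_simps)
  have z': "0 \<le> z' i" if "i < n" for i
    using less.prems(1) app_nonneg[of z i] that by (simp add: z'_def)
  have appd: "0 \<le> app d i" if "i < n" for i using app_nonneg[of d] d that by blast
  show ?case
  proof (cases "\<exists>i<n. d i = 0")
    case True
    have "\<exists>i<n. d i \<noteq> 0" using less.prems(3) by (auto simp: d_def)
    then obtain i where i: "i < n" "d i = 0" "0 < app d i"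
      using support_grows[of d] d True by blast
    show ?thesis
    proof (rule less.hyps)
      show "0 \<le> z' i" if "i < n" for i by (rule z'[OF that])
      show "t * z' i \<le> app z' i" if "i < n" for i
        using d_z'[of i] d[OF that] appd[OF that] by simp
      show "\<exists>i<n. app z' i \<noteq> t * z' i"
        using i d_z'[of i] by (intro exI[of _ i]) auto
      have "{i. i < n \<and> app z' i = t * z' i} \<subseteq> {i. i < n \<and> app z i = t * z i}"
      proof safe
        fix i assume i: "i < n" "app z' i = t * z' i"
        then have "d i + app d i = 0" using d_z'[of i] by simp
        then have "d i = 0" using d[OF i(1)] appd[OF i(1)] by simp
        then show "app z i = t * z i" by (simp add: d_def)
      qed
      moreover have "i \<in> {i. i < n \<and> app z i = t * z i}"
        using i by (simp add: d_def)
      moreover have "i \<notin> {i. i < n \<and> app z' i = t * z' i}"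
        using i d_z'[of i] by auto
      ultimately show "card {i. i < n \<and> app z' i = t * z' i} < card {i. i < n \<and> app z i = t * z i}"
        by (intro psubset_card_mono) auto
    qed
  next
    case False
    then have d0: "0 < d i" if "i < n" for i using d[OF that] that by force
    have "0 < z' i \<and> t * z' i < app z' i" if "i < n" for i
    proof -
      have "0 \<le> t * z i" using assms(4) less.prems(1)[OF that] by simp
      then have "0 < app z i" using d0[OF that] by (simp add: d_def)
      then show ?thesis
        using less.prems(1)[OF that] d_z'[of i] d0[OF that] appd[OF that] by (simp add: z'_def)
    qed
    then show ?thesis by blast
  qed
qed

text \<open>There are only finitely many entries, so a strict inequality leaves room for a uniformly
  larger factor.\<close>

lemma strict_imp_larger_factor:
  assumes w: "\<And>i. i < n \<Longrightarrow> 0 < w i \<and> t * w i < app w i"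
  shows "\<exists>s>t. \<forall>i<n. s * w i \<le> app w i"
proof -
  define s where "s = Min ((\<lambda>i. app w i / w i) ` {..<n})"
  have "t < s"
    unfolding s_def using dim_pos w by (subst Min_gr_iff) (auto simp: pos_less_divide_eq)
  moreover have "s * w i \<le> app w i" if "i < n" for i
  proof -
    have "s \<le> app w i / w i" unfolding s_def using that by (intro Min_le) auto
    then show ?thesis using w[OF that] by (simp add: pos_le_divide_eq)
  qed
  ultimately show ?thesis by blast
qed

text \<open>Take a complex eigenvector \<open>u\<close> whose eigenvalue has modulus \<open>\<rho>\<close>. By the triangle inequality
  \<open>z = |u|\<close> satisfies \<open>B z \<ge> \<rho> z\<close>. If equality failed anywhere, some positive vector would grow by a
  factor larger than \<open>\<rho>\<close>, contrary to \<open>growth_le_spectral_radius\<close>.\<close>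

lemma perron_vector: "\<exists>x. \<forall>i<n. 0 < x i \<and> app x i = rho * x i"
proof -
  define C where "C = mat n n (\<lambda>(i, j). complex_of_real (B i j))"
  have C: "C \<in> carrier_mat n n" by (simp add: C_def)
  obtain k where k: "eigenvalue C k" "rho = norm k"
    using spectral_radius_mem_max(1)[OF C dim_pos] by (auto simp: spectrum_def rho_def C_def)
  obtain u where u: "u \<in> carrier_vec n" "u \<noteq> 0\<^sub>v n" "C *\<^sub>v u = k \<cdot>\<^sub>v u"
    using k(1) C by (auto simp: eigenvalue_def eigenvector_def)
  define z where "z i = norm (u $ i)" for i
  have nz: "\<exists>i<n. z i \<noteq> 0"
    using u(1,2) by (auto simp: z_def)
  have super: "rho * z i \<le> app z i" if "i < n" for i
  proof -
    have "k * u $ i = (\<Sum>j<n. complex_of_real (B i j) * u $ j)"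
      using arg_cong[OF u(3), of "\<lambda>v. v $ i"] u(1) that
      by (simp add: C_def scalar_prod_def lessThan_atLeast0)
    then have "rho * z i = norm (\<Sum>j<n. complex_of_real (B i j) * u $ j)"
      by (metis k(2) norm_mult z_def)
    also have "\<dots> \<le> (\<Sum>j<n. norm (complex_of_real (B i j) * u $ j))"
      by (rule norm_sum)
    also have "\<dots> = app z i"
      unfolding app_def z_def using nonneg that by (intro sum.cong) (auto simp: norm_mult)
    finally show ?thesis .
  qed
  have z0: "0 \<le> z i" for i by (simp add: z_def)
  have eq: "app z i = rho * z i" if i: "i < n" for i
  proof (rule ccontr)
    assume "app z i \<noteq> rho * z i"
    then obtain w where w: "\<forall>i<n. 0 < w i \<and> rho * w i < app w i"
      using strict_superinvariant[of z rho] z0 super i k(2) by auto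
    then obtain s where s: "rho < s" "\<forall>i<n. s * w i \<le> app w i"
      using strict_imp_larger_factor[of w rho] by blast
    have "s \<le> rho"
      unfolding rho_def
      by (rule growth_le_spectral_radius[where z = w])
        (use dim_pos nonneg w s(2) in \<open>auto simp: app_def\<close>)
    then show False using s(1) by simp
  qed
  have "0 < z i" if "i < n" for i
    using subinvariant_positive[of z rho] z0 nz eq that by force
  then show ?thesis using eq by blast
qed

text \<open>Subtract from \<open>u\<close> the multiple of \<open>x\<close> that makes the difference nonnegative with a zero entry.
  The difference lies in the eigenspace, so it would be positive if it were nonzero.\<close>

lemma eigenvector_unique:
  assumes x: "\<And>i. i < n \<Longrightarrow> 0 < x i" "\<And>i. i < n \<Longrightarrow> app x i = k * x i"
    and u: "\<And>i. i < n \<Longrightarrow> app u i = k * u i"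
  shows "\<exists>c. \<forall>i<n. u i = c * x i"
proof -
  define c where "c = Min ((\<lambda>i. u i / x i) ` {..<n})"
  have "c \<in> (\<lambda>i. u i / x i) ` {..<n}"
    unfolding c_def using dim_pos by (intro Min_in) auto
  then obtain m where m: "m < n" "c = u m / x m" by auto
  have ge: "0 \<le> u i - c * x i" if "i < n" for i
  proof -
    have "c \<le> u i / x i" unfolding c_def using that by (intro Min_le) auto
    then show ?thesis using x(1)[OF that] by (simp add: pos_le_divide_eq)
  qed
  have zero: "u m - c * x m = 0" using m x(1)[of m] by simp
  have "u i - c * x i = 0" if "i < n" for i
  proof (rule ccontr)
    assume "u i - c * x i \<noteq> 0"
    then have nz: "\<exists>i<n. u i - c * x i \<noteq> 0" using that by blast
    have sub: "app (\<lambda>i. u i - c * x i) j \<le> k * (u j - c * x j)" if "j < n" for j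
      using x(2)[OF that] u[OF that] by (simp add: app_diff app_scale algebra_simps)
    have "0 < u m - c * x m"
      by (rule subinvariant_positive[of "\<lambda>i. u i - c * x i" k, OF ge nz sub m(1)])
    then show False using zero by simp
  qed
  then have "\<forall>i<n. u i = c * x i" by simp
  then show ?thesis by (rule exI[of _ c])
qed

lemma complex_eigenvector_unique:
  fixes u :: "nat \<Rightarrow> complex"
  assumes x: "\<And>i. i < n \<Longrightarrow> 0 < x i" "\<And>i. i < n \<Longrightarrow> app x i = k * x i"
    and u: "\<And>i. i < n \<Longrightarrow> (\<Sum>j<n. complex_of_real (B i j) * u j) = complex_of_real k * u i"
  shows "\<exists>c. \<forall>i<n. u i = c * complex_of_real (x i)"
proof -
  have "app (\<lambda>i. Re (u i)) i = k * Re (u i)" "app (\<lambda>i. Im (u i)) i = k * Im (u i)" if "i < n" for i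
    using arg_cong[OF u[OF that], of Re] arg_cong[OF u[OF that], of Im] by (simp_all add: app_def)
  then obtain a b where "\<forall>i<n. Re (u i) = a * x i" "\<forall>i<n. Im (u i) = b * x i"
    using eigenvector_unique[OF x, of "\<lambda>i. Re (u i)"] eigenvector_unique[OF x, of "\<lambda>i. Im (u i)"]
    by blast
  then show ?thesis
    by (intro exI[of _ "Complex a b"]) (auto simp: complex_eq_iff)
qed

lemma transposed: "irreducible_nonneg n (\<lambda>i j. B j i)"
proof
  show "n > 0" by (rule dim_pos)
  show "0 \<le> B j i" if "i < n" "j < n" for i j using nonneg that by simp
  fix S assume S: "S \<subseteq> {..<n}" "S \<noteq> {}" "\<And>i j. i \<in> {..<n} - S \<Longrightarrow> j \<in> S \<Longrightarrow> B j i = 0"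
  show "S = {..<n}"
  proof (rule ccontr)
    assume "S \<noteq> {..<n}"
    then have "{..<n} - S \<noteq> {}" using S(1) by blast
    then have "{..<n} - S = {..<n}"
      using S(3) by (intro irred) auto
    then show False using S(1,2) by blast
  qed
qed

text \<open>The transposed matrix has a Perron vector for its own spectral radius. That this is the same
  number follows from evaluating \<open>y\<^sup>T B x\<close> in two ways, as \<open>y\<^sup>T x > 0\<close>.\<close>

lemma left_perron_vector: "\<exists>y. \<forall>j<n. 0 < y j \<and> (\<Sum>i<n. B i j * y i) = rho * y j"
proof -
  interpret T: irreducible_nonneg n "\<lambda>i j. B j i" by (rule transposed)
  obtain x where x: "\<forall>i<n. 0 < x i \<and> app x i = rho * x i" using perron_vector by blast
  obtain y where y: "\<forall>i<n. 0 < y i \<and> T.app y i = T.rho * y i" using T.perron_vector by blast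
  have "T.rho * (\<Sum>j<n. y j * x j) = (\<Sum>i<n. y i * (\<Sum>j<n. B i j * x j))"
    using y by (subst left_eigen_sum) (auto simp: T.app_def)
  also have "\<dots> = rho * (\<Sum>j<n. y j * x j)"
    using x by (simp add: app_def sum_distrib_left mult_ac)
  finally have "T.rho * (\<Sum>j<n. y j * x j) = rho * (\<Sum>j<n. y j * x j)" .
  moreover have "0 < (\<Sum>j<n. y j * x j)"
    using x y dim_pos by (intro sum_pos) auto
  ultimately have "T.rho = rho" by simp
  then show ?thesis using y by (auto simp: T.app_def)
qed

text \<open>The range of \<open>B - k\<close> contains every \<open>b\<close> orthogonal to \<open>y\<close>. The rank one perturbation
  \<open>M = B - k - x y\<^sup>T\<close> is invertible, and it agrees with \<open>B - k\<close> on the complement of \<open>y\<close>; the solution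
  of \<open>M v = b\<close> lies in that complement, because \<open>y\<^sup>T M v = - (y\<^sup>T x) (y\<^sup>T v)\<close>.\<close>

lemma fredholm_alternative:
  assumes x: "\<And>i. i < n \<Longrightarrow> 0 < x i" "\<And>i. i < n \<Longrightarrow> app x i = k * x i"
    and y: "\<And>j. j < n \<Longrightarrow> 0 < y j" "\<And>j. j < n \<Longrightarrow> (\<Sum>i<n. B i j * y i) = k * y j"
    and b: "(\<Sum>i<n. y i * b i) = 0"
  shows "\<exists>v. \<forall>i<n. app v i - k * v i = b i"
proof -
  define M where "M = mat n n (\<lambda>(i, j). B i j - (if i = j then k else 0) - x i * y j)"
  have M: "M \<in> carrier_mat n n" by (simp add: M_def)
  have pos: "0 < (\<Sum>i<n. y i * x i)" using x y dim_pos by (intro sum_pos) auto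
  have Mv: "(M *\<^sub>v v) $ i = app (\<lambda>i. v $ i) i - k * v $ i - x i * (\<Sum>j<n. y j * v $ j)"
    if "v \<in> carrier_vec n" "i < n" for v i
  proof -
    have "(M *\<^sub>v v) $ i = (\<Sum>j<n. (B i j - (if i = j then k else 0) - x i * y j) * v $ j)"
      using that by (simp add: M_def scalar_prod_def lessThan_atLeast0)
    also have "\<dots> = (\<Sum>j<n. B i j * v $ j - (if i = j then k * v $ j else 0) - x i * (y j * v $ j))"
      by (intro sum.cong) (auto simp: algebra_simps)
    also have "\<dots> = app (\<lambda>i. v $ i) i - k * v $ i - x i * (\<Sum>j<n. y j * v $ j)"
      using that by (simp add: sum_subtractf app_def sum_distrib_left)
    finally show ?thesis .
  qed
  \<comment> \<open>Serves twice: with \<open>g = 0\<close> for the injectivity of \<open>M\<close>, with \<open>g = b\<close> for the solution.\<close>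
  have key: "(\<Sum>j<n. y j * v $ j) = 0 \<and> (\<forall>i<n. app (\<lambda>i. v $ i) i - k * v $ i = g i)"
    if v: "v \<in> carrier_vec n" "\<And>i. i < n \<Longrightarrow> (M *\<^sub>v v) $ i = g i" and g: "(\<Sum>i<n. y i * g i) = 0"
    for v g
  proof -
    define s where "s = (\<Sum>j<n. y j * v $ j)"
    have gi: "g i = app (\<lambda>i. v $ i) i - k * v $ i - x i * s" if "i < n" for i
      unfolding s_def v(2)[OF that, symmetric] by (rule Mv[OF v(1) that])
    have "0 = (\<Sum>i<n. y i * (app (\<lambda>i. v $ i) i - k * v $ i - x i * s))"
      unfolding g[symmetric] by (intro sum.cong refl) (simp only: gi lessThan_iff)
    also have "\<dots> = (\<Sum>i<n. y i * app (\<lambda>i. v $ i) i) - k * (\<Sum>i<n. y i * v $ i)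
        - (\<Sum>i<n. y i * x i) * s"
      by (simp add: right_diff_distrib sum_subtractf sum_distrib_left sum_distrib_right mult_ac)
    also have "(\<Sum>i<n. y i * app (\<lambda>i. v $ i) i) = k * (\<Sum>i<n. y i * v $ i)"
      unfolding app_def using y by (intro left_eigen_sum)
    finally have "(\<Sum>i<n. y i * x i) * s = 0" by simp
    then have "s = 0" using pos by (metis less_irrefl mult_eq_0_iff)
    then show ?thesis using gi by (simp add: s_def[symmetric])
  qed
  have "det M \<noteq> 0"
  proof
    assume "det M = 0"
    then obtain v where v: "v \<in> carrier_vec n" "v \<noteq> 0\<^sub>v n" "M *\<^sub>v v = 0\<^sub>v n"
      using det_0_iff_vec_prod_zero[OF M] by auto
    have v0: "(\<Sum>j<n. y j * v $ j) = 0" "\<forall>i<n. app (\<lambda>i. v $ i) i - k * v $ i = 0"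
      using key[OF v(1), of "\<lambda>_. 0"] v(3) by auto
    obtain c where c: "\<forall>i<n. v $ i = c * x i"
      using eigenvector_unique[OF x, of "\<lambda>i. v $ i"] v0(2) by auto
    have "c * (\<Sum>i<n. y i * x i) = 0"
      using v0(1) c by (simp add: sum_distrib_left mult_ac)
    then have "c = 0" using pos by simp
    then have "v = 0\<^sub>v n" using v(1) c by (intro eq_vecI) auto
    then show False using v(2) by simp
  qed
  then obtain N where N: "N \<in> carrier_mat n n" "M * N = 1\<^sub>m n"
    using det_non_zero_imp_unit[OF M, of "()"] M
    by (auto simp: Units_def ring_mat_def)
  have "M *\<^sub>v (N *\<^sub>v vec n b) = vec n b"
    using N M by (simp add: assoc_mult_mat_vec[symmetric, of _ n n _ n])
  then have "(M *\<^sub>v (N *\<^sub>v vec n b)) $ i = b i" if "i < n" for i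
    using that by simp
  then show ?thesis
    using key[of "N *\<^sub>v vec n b" b] b N
    by (intro exI[of _ "\<lambda>i. (N *\<^sub>v vec n b) $ i"]) auto
qed

end

text \<open>An invariant set \<open>S\<close> of indices yields a block triangular form by any permutation that moves
  the first \<open>card S\<close> indices onto \<open>S\<close>.\<close>

lemma irreducible_mat_imp_irreducible_nonneg:
  assumes n: "n > 0" and M: "M \<in> carrier_mat n n"
    and "nonnegative_mat M" and irr: "irreducible_mat M"
  shows "irreducible_nonneg n (\<lambda>i j. M $$ (i, j))"
proof
  show "n > 0" by (rule n)
  show "0 \<le> M $$ (i, j)" if "i < n" "j < n" for i j
    using assms(3) M that by (auto simp: nonnegative_mat_def)
  fix S assume S: "S \<subseteq> {..<n}" "S \<noteq> {}"
    and zero: "\<And>i j. i \<in> {..<n} - S \<Longrightarrow> j \<in> S \<Longrightarrow> M $$ (i, j) = 0"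
  show "S = {..<n}"
  proof (rule ccontr)
    assume ne: "S \<noteq> {..<n}"
    define r where "r = card S"
    have fin: "finite S" using S(1) finite_subset by blast
    have r: "0 < r" "r < n"
      using S ne fin psubset_card_mono[of "{..<n}" S] by (auto simp: r_def card_gt_0_iff)
    obtain f where f: "bij_betw f {..<r} S"
      using finite_same_card_bij[of "{..<r}" S] fin by (auto simp: r_def)
    obtain g where g: "bij_betw g {r..<n} ({..<n} - S)"
      using finite_same_card_bij[of "{r..<n}" "{..<n} - S"] S(1) fin
      by (auto simp: r_def card_Diff_subset)
    define p where "p i = (if i < r then f i else if i < n then g i else i)" for i
    have p1: "bij_betw p {..<r} S"
      by (rule iffD1[OF bij_betw_cong f]) (auto simp: p_def)
    have p2: "bij_betw p {r..<n} ({..<n} - S)"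
      by (rule iffD1[OF bij_betw_cong g]) (auto simp: p_def)
    have "bij_betw p ({..<r} \<union> {r..<n}) (S \<union> ({..<n} - S))"
      by (rule bij_betw_combine[OF p1 p2]) auto
    moreover have "{..<r} \<union> {r..<n} = {..<n}" "S \<union> ({..<n} - S) = {..<n}"
      using r S(1) by auto
    ultimately have perm: "p permutes {..<n}"
      using r by (intro bij_imp_permutes) (auto simp: p_def)
    define P where "P = mat n n (\<lambda>(i, j). M $$ (p i, p j))"
    obtain B C Z D where split: "split_block P r r = (B, C, Z, D)"
      by (metis prod_cases4)
    have dims: "dim_row P = r + (n - r)" "dim_col P = r + (n - r)"
      using r by (auto simp: P_def)
    note sb = split_block[OF split dims]
    have "Z = 0\<^sub>m (n - r) r"
    proof (rule eq_matI)
      fix i j assume ij: "i < dim_row (0\<^sub>m (n - r) r :: real mat)" "j < dim_col (0\<^sub>m (n - r) r :: real mat)"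
      have "p (i + r) \<in> {..<n} - S"
        using ij p2 by (auto dest!: bij_betwE)
      moreover have "p j \<in> S"
        using ij p1 by (auto dest!: bij_betwE)
      ultimately show "Z $$ (i, j) = (0\<^sub>m (n - r) r) $$ (i, j)"
        using split ij r zero by (auto simp: split_block_def Let_def P_def)
    qed (use sb in auto)
    then have "mat n n (\<lambda>(i, j). M $$ (p i, p j)) = four_block_mat B C (0\<^sub>m (n - r) r) D"
      using sb(5) by (simp only: P_def)
    moreover have "dim_row M = n" using M by simp
    ultimately have "reducible_mat M"
      unfolding reducible_mat_def Let_def using sb(1,2,4) perm r by blast
    then show False using irr by (simp add: irreducible_mat_def)
  qed
qed

section \<open>Dual numbers and their eigenvectors\<close>

lemma dual_num_eq_iff: "a = b \<longleftrightarrow> std_part a = std_part b \<and> dual_part a = dual_part b"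
  by (cases a; cases b) simp

lemma std_part_zero [simp]: "std_part 0 = 0"
  and dual_part_zero [simp]: "dual_part 0 = 0"
  and std_part_add [simp]: "std_part (a + b) = std_part a + std_part b"
  and dual_part_add [simp]: "dual_part (a + b) = dual_part a + dual_part b"
  and std_part_mult [simp]: "std_part (a * b) = std_part a * std_part b"
  and dual_part_mult [simp]:
    "dual_part (a * b) = std_part a * dual_part b + dual_part a * std_part b"
  by (simp_all add: zero_dual_num_def plus_dual_num_def times_dual_num_def)

lemma std_part_sum [simp]: "std_part (sum f S) = (\<Sum>i\<in>S. std_part (f i))"
  by (induction S rule: infinite_finite_induct) auto

lemma dual_part_sum [simp]: "dual_part (sum f S) = (\<Sum>i\<in>S. dual_part (f i))"
  by (induction S rule: infinite_finite_induct) auto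

lemma mult_mat_vec_dual:
  fixes A :: "'a :: comm_ring_1 dual_num mat"
  assumes "A \<in> carrier_mat n n" "x \<in> carrier_vec n" "i < n"
  shows "(A *\<^sub>v x) $ i = Dual (\<Sum>j<n. std_part (A $$ (i, j)) * std_part (x $ j))
    ((\<Sum>j<n. std_part (A $$ (i, j)) * dual_part (x $ j)) +
     (\<Sum>j<n. dual_part (A $$ (i, j)) * std_part (x $ j)))"
  using assms
  by (intro dual_num.expand) (auto simp: scalar_prod_def lessThan_atLeast0 sum.distrib)

text \<open>The eigenvector equation in terms of the parts: the standard parts form an ordinary
  eigenvector, and the dual parts satisfy an inhomogeneous linear system.\<close>

lemma dual_eigenvector_iff:
  fixes A :: "complex dual_num mat"
  assumes A: "A \<in> carrier_mat n n" and x: "x \<in> carrier_vec n"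
  shows "dual_eigenvector A x lam \<longleftrightarrow>
    (\<exists>i<n. std_part (x $ i) \<noteq> 0) \<and>
    (\<forall>i<n. (\<Sum>j<n. std_part (A $$ (i, j)) * std_part (x $ j)) = std_part lam * std_part (x $ i)) \<and>
    (\<forall>i<n. (\<Sum>j<n. std_part (A $$ (i, j)) * dual_part (x $ j)) +
           (\<Sum>j<n. dual_part (A $$ (i, j)) * std_part (x $ j)) =
           std_part lam * dual_part (x $ i) + dual_part lam * std_part (x $ i))"
proof -
  have "map_vec std_part x \<noteq> 0\<^sub>v n \<longleftrightarrow> (\<exists>i<n. std_part (x $ i) \<noteq> 0)"
    using x by (auto simp: vec_eq_iff)
  moreover have "A *\<^sub>v x = lam \<cdot>\<^sub>v x \<longleftrightarrow> (\<forall>i<n. (A *\<^sub>v x) $ i = lam * x $ i)"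
    using A x by (auto simp: vec_eq_iff simp del: index_mult_mat_vec)
  ultimately show ?thesis
    using A x unfolding dual_eigenvector_def
    by (simp add: mult_mat_vec_dual[OF A x] dual_num_eq_iff imp_conjR all_conj_distrib
        del: index_mult_mat_vec)
qed

context irreducible_nonneg
begin

text \<open>For positive \<open>z\<close>, the case \<open>\<sigma> = 1\<close> says that not all quotients of \<open>z + w \<epsilon>\<close> exceed
  \<open>k + \<mu> \<epsilon>\<close>, and the case \<open>\<sigma> = -1\<close> that not all are below it. The sum of \<open>d\<close> with the positive
  weights \<open>y\<close> is zero, which forces the nonnegative \<open>d\<close> to vanish. Then \<open>z\<close> is a multiple of \<open>x\<close>, so
  that the weighted sum of the positive \<open>e\<close> is zero as well, which is impossible.\<close>

lemma no_uniformly_strict_bound: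
  assumes y: "\<And>j. j < n \<Longrightarrow> 0 < y j" "\<And>j. j < n \<Longrightarrow> (\<Sum>i<n. B i j * y i) = k * y j"
    and x: "\<And>i. i < n \<Longrightarrow> 0 < x i" "\<And>i. i < n \<Longrightarrow> app x i = k * x i"
    and mu: "(\<Sum>i<n. y i * (\<Sum>j<n. D i j * x j)) = \<mu> * (\<Sum>i<n. y i * x i)"
    and less: "\<And>i. i < n \<Longrightarrow> 0 < \<sigma> * (app z i - k * z i) \<or> app z i = k * z i \<and>
        0 < \<sigma> * (app w i + (\<Sum>j<n. D i j * z j) - (k * w i + \<mu> * z i))"
  shows False
proof -
  define d where "d i = \<sigma> * (app z i - k * z i)" for i
  define e where "e i = \<sigma> * (app w i + (\<Sum>j<n. D i j * z j) - (k * w i + \<mu> * z i))" for i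
  have left: "(\<Sum>i<n. y i * app v i) = k * (\<Sum>i<n. y i * v i)" for v
    unfolding app_def using y by (intro left_eigen_sum)
  have "(\<Sum>i<n. y i * d i) = \<sigma> * ((\<Sum>i<n. y i * app z i) - k * (\<Sum>i<n. y i * z i))"
    by (simp add: d_def algebra_simps sum_distrib_left sum_subtractf)
  then have "(\<Sum>i<n. y i * d i) = 0" by (simp add: left)
  moreover have "\<forall>i\<in>{..<n}. 0 \<le> y i * d i"
    using less y(1) by (fastforce simp: d_def)
  ultimately have "\<forall>i\<in>{..<n}. y i * d i = 0"
    by (subst (asm) sum_nonneg_eq_0_iff) auto
  then have d0: "d i = 0" if "i < n" for i using y(1)[OF that] that by force
  then have z: "app z i = k * z i" and e: "0 < e i" if "i < n" for i
    using less[OF that] d0[OF that] unfolding d_def e_def by (metis less_irrefl)+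
  obtain c where c: "\<forall>i<n. z i = c * x i"
    using eigenvector_unique[OF x z] by blast
  have "0 < (\<Sum>i<n. y i * e i)" using y(1) e dim_pos by (intro sum_pos) auto
  also have "(\<Sum>i<n. y i * e i) = \<sigma> * ((\<Sum>i<n. y i * app w i) - k * (\<Sum>i<n. y i * w i)
      + ((\<Sum>i<n. y i * (\<Sum>j<n. D i j * z j)) - \<mu> * (\<Sum>i<n. y i * z i)))"
    by (simp add: e_def algebra_simps sum_distrib_left sum_subtractf sum.distrib)
  also have "(\<Sum>i<n. y i * (\<Sum>j<n. D i j * z j)) = c * (\<Sum>i<n. y i * (\<Sum>j<n. D i j * x j))"
    using c by (simp add: sum_distrib_left mult_ac)
  also have "(\<Sum>i<n. y i * z i) = c * (\<Sum>i<n. y i * x i)"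
    using c by (simp add: sum_distrib_left mult_ac)
  finally show False using mu by (simp add: left)
qed

end

text \<open>The hypothesis on \<open>v\<close> makes \<open>x + v \<epsilon>\<close> an eigenvector, which gives existence. Uniqueness is by
  pairing with \<open>y\<close>: a competing complex eigenvector has standard part \<open>c x\<close> with \<open>c \<noteq> 0\<close>, and its
  eigenvalue has the dual part \<open>y\<^sup>T D x / y\<^sup>T x\<close>, which is \<open>\<mu>\<close> by the same computation for
  \<open>x + v \<epsilon>\<close>.\<close>

lemma perron_frobenius_eigenvalue_eq:
  assumes A: "A \<in> carrier_mat n n"
    and "irreducible_nonneg n B"
    and B: "\<And>i j. B i j = std_part (A $$ (i, j))" and D: "\<And>i j. D i j = dual_part (A $$ (i, j))"
    and k: "k = irreducible_nonneg.rho n B"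
    and y: "\<And>j. j < n \<Longrightarrow> 0 < y j" "\<And>j. j < n \<Longrightarrow> (\<Sum>i<n. B i j * y i) = k * y j"
    and x: "\<And>i. i < n \<Longrightarrow> 0 < x i" "\<And>i. i < n \<Longrightarrow> (\<Sum>j<n. B i j * x j) = k * x i"
    and v: "\<And>i. i < n \<Longrightarrow> (\<Sum>j<n. B i j * v j) + (\<Sum>j<n. D i j * x j) = k * v i + \<mu> * x i"
  shows "perron_frobenius_eigenvalue A = Dual k \<mu>"
proof -
  interpret irreducible_nonneg n B by fact
  define Ac where "Ac = map_mat complex_of_dual A"
  have Ac: "Ac \<in> carrier_mat n n" using A by (simp add: Ac_def)
  have stdAc: "std_part (Ac $$ (i, j)) = complex_of_real (B i j)"
    and dualAc: "dual_part (Ac $$ (i, j)) = complex_of_real (D i j)" if "i < n" "j < n" for i j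
    using A that by (simp_all add: Ac_def B D dual_num.map_sel)
  have "map_mat complex_of_real (map_mat std_part A) = mat n n (\<lambda>(i, j). complex_of_real (B i j))"
    using A by (auto simp: B)
  then have rad: "spectral_radius (map_mat complex_of_real (map_mat std_part A)) = k"
    by (simp add: k rho_def)
  have x': "\<And>i. i < n \<Longrightarrow> app x i = k * x i" using x by (simp add: app_def)
  have pos: "0 < (\<Sum>i<n. y i * x i)" using x y dim_pos by (intro sum_pos) auto
  have mu: "(\<Sum>i<n. y i * (\<Sum>j<n. D i j * x j)) = \<mu> * (\<Sum>i<n. y i * x i)"
  proof -
    have "(\<Sum>j<n. D i j * x j) = k * v i + \<mu> * x i - (\<Sum>j<n. B i j * v j)" if "i < n" for i
      using v[OF that] by linarith
    then have "(\<Sum>i<n. y i * (\<Sum>j<n. D i j * x j))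
        = (\<Sum>i<n. y i * (k * v i + \<mu> * x i - (\<Sum>j<n. B i j * v j)))"
      by simp
    also have "\<dots> = k * (\<Sum>i<n. y i * v i) + \<mu> * (\<Sum>i<n. y i * x i)
        - (\<Sum>i<n. y i * (\<Sum>j<n. B i j * v j))"
      by (simp add: algebra_simps sum_distrib_left sum_subtractf sum.distrib)
    also have "(\<Sum>i<n. y i * (\<Sum>j<n. B i j * v j)) = k * (\<Sum>i<n. y i * v i)"
      using y by (intro left_eigen_sum)
    finally show ?thesis by simp
  qed
  have unique: "\<nu> = complex_of_dual (Dual k \<mu>)"
    if ev: "dual_eigenvector Ac X \<nu>" and std: "std_part \<nu> = complex_of_real k" for X \<nu>
  proof -
    have X: "X \<in> carrier_vec n" using ev Ac by (auto simp: dual_eigenvector_def)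
    define u where "u i = std_part (X $ i)" for i
    define q where "q i = dual_part (X $ i)" for i
    have u0: "\<exists>i<n. u i \<noteq> 0"
      and u: "\<And>i. i < n \<Longrightarrow> (\<Sum>j<n. complex_of_real (B i j) * u j) = complex_of_real k * u i"
      and q: "\<And>i. i < n \<Longrightarrow> (\<Sum>j<n. complex_of_real (B i j) * q j) +
          (\<Sum>j<n. complex_of_real (D i j) * u j) = complex_of_real k * q i + dual_part \<nu> * u i"
      using ev std by (auto simp: dual_eigenvector_iff[OF Ac X] stdAc dualAc u_def q_def)
    obtain c where c: "\<forall>i<n. u i = c * complex_of_real (x i)"
      using complex_eigenvector_unique[OF x(1) x' u] by blast
    have c0: "c \<noteq> 0" using c u0 by auto
    let ?y = "\<lambda>i. complex_of_real (y i)"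
    have "(\<Sum>i<n. ?y i * (\<Sum>j<n. complex_of_real (B i j) * q j)) =
        complex_of_real k * (\<Sum>i<n. ?y i * q i)"
      using y(2) by (intro left_eigen_sum) (simp flip: of_real_mult of_real_sum)
    moreover have "(\<Sum>i<n. ?y i * ((\<Sum>j<n. complex_of_real (B i j) * q j) +
          (\<Sum>j<n. complex_of_real (D i j) * u j))) =
        (\<Sum>i<n. ?y i * (complex_of_real k * q i + dual_part \<nu> * u i))"
      using q by simp
    ultimately have "(\<Sum>i<n. ?y i * (\<Sum>j<n. complex_of_real (D i j) * u j)) =
        dual_part \<nu> * (\<Sum>i<n. ?y i * u i)"
      by (simp add: algebra_simps sum.distrib sum_distrib_left)
    moreover have "(\<Sum>i<n. ?y i * (\<Sum>j<n. complex_of_real (D i j) * u j)) =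
        c * complex_of_real (\<mu> * (\<Sum>i<n. y i * x i))"
      unfolding mu[symmetric] using c by (simp add: sum_distrib_left mult_ac)
    moreover have "(\<Sum>i<n. ?y i * u i) = c * complex_of_real (\<Sum>i<n. y i * x i)"
      using c by (simp add: sum_distrib_left mult_ac)
    ultimately have "dual_part \<nu> = complex_of_real \<mu>"
      using c0 pos by (simp del: of_real_sum)
    then show ?thesis using std by (cases \<nu>) simp
  qed
  define X where "X = vec n (\<lambda>i. complex_of_dual (Dual (x i) (v i)))"
  have X: "X \<in> carrier_vec n" by (simp add: X_def)
  have "dual_eigenvector Ac X (complex_of_dual (Dual k \<mu>))"
    unfolding dual_eigenvector_iff[OF Ac X]
  proof (intro conjI allI impI)
    show "\<exists>i<n. std_part (X $ i) \<noteq> 0"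
      using dim_pos x(1)[of 0] by (intro exI[of _ 0]) (simp add: X_def)
    fix i assume i: "i < n"
    show "(\<Sum>j<n. std_part (Ac $$ (i, j)) * std_part (X $ j)) =
        std_part (complex_of_dual (Dual k \<mu>)) * std_part (X $ i)"
      using arg_cong[OF x(2)[OF i], of complex_of_real] i by (simp add: stdAc X_def)
    show "(\<Sum>j<n. std_part (Ac $$ (i, j)) * dual_part (X $ j)) +
        (\<Sum>j<n. dual_part (Ac $$ (i, j)) * std_part (X $ j)) =
        std_part (complex_of_dual (Dual k \<mu>)) * dual_part (X $ i) +
        dual_part (complex_of_dual (Dual k \<mu>)) * std_part (X $ i)"
      using arg_cong[OF v[OF i], of complex_of_real] i by (simp add: stdAc dualAc X_def)
  qed
  then have "dual_eigenvalue Ac (complex_of_dual (Dual k \<mu>))"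
    unfolding dual_eigenvalue_def by blast
  moreover have "std_part (complex_of_dual (Dual k \<mu>)) = complex_of_real k" by simp
  ultimately have set: "{\<nu>. dual_eigenvalue Ac \<nu> \<and> std_part \<nu> = complex_of_real k} =
      {complex_of_dual (Dual k \<mu>)}"
    using unique unfolding dual_eigenvalue_def by blast
  have inj: "lam = lam'" if "complex_of_dual lam = complex_of_dual lam'" for lam lam'
    using that by (cases lam; cases lam') auto
  show ?thesis
    unfolding perron_frobenius_eigenvalue_def rad Ac_def[symmetric] set
    by (rule the_equality) (rule refl, rule inj, simp only: singleton_inject)
qed

text \<open>A positive standard part makes a dual number invertible and multiplication by it strictly
  monotone, so it may be cleared from the denominator as over an ordered field.\<close>

lemma less_divide_dual_iff:
  fixes a b c :: "real dual_num"
  assumes b: "0 < std_part b"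
  shows "c < a / b \<longleftrightarrow> c * b < a" and "a / b < c \<longleftrightarrow> a < c * b"
proof -
  define p q r s e f where "p = std_part a" and "q = dual_part a" and "r = std_part b"
    and "s = dual_part b" and "e = std_part c" and "f = dual_part c"
  note parts = p_def q_def r_def s_def e_def f_def
  have r: "0 < r" using b by (simp add: r_def)
  have quot: "std_part (a / b) = p / r" "dual_part (a / b) = q / r - p / r * (s / r)"
    and prod: "std_part (c * b) = e * r" "dual_part (c * b) = e * s + f * r"
    by (simp_all add: divide_dual_num_def times_dual_num_def parts)
  have eq: "p / r = e \<longleftrightarrow> p = e * r"
    using r by (simp add: divide_eq_eq)
  have "q / r - e * (s / r) = (q - e * s) / r"
    by (simp add: diff_divide_distrib)
  then have lt: "f < q / r - e * (s / r) \<longleftrightarrow> e * s + f * r < q"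
    "q / r - e * (s / r) < f \<longleftrightarrow> q < e * s + f * r"
    using r by (simp_all only: pos_less_divide_eq pos_divide_less_eq) linarith+
  have "c < a / b \<longleftrightarrow> e < p / r \<or> p / r = e \<and> f < q / r - e * (s / r)"
    unfolding less_dual_num_def quot e_def[symmetric] f_def[symmetric] by metis
  also have "\<dots> \<longleftrightarrow> e * r < p \<or> p = e * r \<and> e * s + f * r < q"
    by (simp only: eq lt pos_less_divide_eq[OF r])
  also have "\<dots> \<longleftrightarrow> c * b < a"
    unfolding less_dual_num_def prod by (auto simp: p_def q_def)
  finally show "c < a / b \<longleftrightarrow> c * b < a" .
  have "a / b < c \<longleftrightarrow> p / r < e \<or> p / r = e \<and> q / r - e * (s / r) < f"
    unfolding less_dual_num_def quot e_def[symmetric] f_def[symmetric] by metis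
  also have "\<dots> \<longleftrightarrow> p < e * r \<or> p = e * r \<and> q < e * s + f * r"
    by (simp only: eq lt pos_divide_less_eq[OF r])
  also have "\<dots> \<longleftrightarrow> a < c * b"
    unfolding less_dual_num_def prod by (auto simp: p_def q_def)
  finally show "a / b < c \<longleftrightarrow> a < c * b" .
qed

section \<open>The Collatz-Wielandt formula for dual number matrices\<close>

theorem theorem5p2:
  fixes n :: nat and A :: "real dual_num mat" and lam :: "real dual_num"
  assumes "n > 0"
    and "A \<in> carrier_mat n n"
    and "nonnegative_mat (map_mat std_part A)"
    and "irreducible_mat (map_mat std_part A)"
    and "lam = perron_frobenius_eigenvalue A"
  shows "(\<forall>x \<in> carrier_vec n. positive_dual_vec x \<longrightarrow>
            Min ((\<lambda>i. (A *\<^sub>v x) $ i / x $ i) ` {..<n}) \<le> lam \<and>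
            lam \<le> Max ((\<lambda>i. (A *\<^sub>v x) $ i / x $ i) ` {..<n})) \<and>
         is_maximum {Min ((\<lambda>i. (A *\<^sub>v x) $ i / x $ i) ` {..<n}) | x.
                       x \<in> carrier_vec n \<and> positive_dual_vec x} lam \<and>
         is_minimum {Max ((\<lambda>i. (A *\<^sub>v x) $ i / x $ i) ` {..<n}) | x.
                       x \<in> carrier_vec n \<and> positive_dual_vec x} lam"
proof -
  note n = assms(1) and A = assms(2)
  define B where "B i j = std_part (A $$ (i, j))" for i j
  define D where "D i j = dual_part (A $$ (i, j))" for i j
  have "irreducible_nonneg n (\<lambda>i j. map_mat std_part A $$ (i, j))"
    using assms by (intro irreducible_mat_imp_irreducible_nonneg) auto
  then interpret irreducible_nonneg n B
    using A by (auto simp: irreducible_nonneg_def B_def subset_iff Ball_def)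
  obtain x where x: "\<And>i. i < n \<Longrightarrow> 0 < x i" "\<And>i. i < n \<Longrightarrow> app x i = rho * x i"
    using perron_vector by blast
  obtain y where y: "\<And>j. j < n \<Longrightarrow> 0 < y j" "\<And>j. j < n \<Longrightarrow> (\<Sum>i<n. B i j * y i) = rho * y j"
    using left_perron_vector by blast
  define \<mu> where "\<mu> = (\<Sum>i<n. y i * (\<Sum>j<n. D i j * x j)) / (\<Sum>i<n. y i * x i)"
  have pos: "0 < (\<Sum>i<n. y i * x i)" using x y n by (intro sum_pos) auto
  have mu: "(\<Sum>i<n. y i * (\<Sum>j<n. D i j * x j)) = \<mu> * (\<Sum>i<n. y i * x i)"
    using pos by (simp add: \<mu>_def)
  have "(\<Sum>i<n. y i * (\<mu> * x i - (\<Sum>j<n. D i j * x j))) = 0"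
    using mu by (simp add: right_diff_distrib sum_subtractf sum_distrib_left mult_ac)
  then obtain v where v: "\<And>i. i < n \<Longrightarrow> app v i - rho * v i = \<mu> * x i - (\<Sum>j<n. D i j * x j)"
    using fredholm_alternative[OF x y, of "\<lambda>i. \<mu> * x i - (\<Sum>j<n. D i j * x j)"] by blast
  have v': "app v i + (\<Sum>j<n. D i j * x j) = rho * v i + \<mu> * x i" if "i < n" for i
    using v[OF that] by simp
  have lam: "lam = Dual rho \<mu>"
    unfolding assms(5)
    by (rule perron_frobenius_eigenvalue_eq[OF A irreducible_nonneg_axioms, of D _ y x v])
      (use x y v' in \<open>auto simp: B_def D_def app_def\<close>)
  have Ax: "(A *\<^sub>v X) $ i = Dual (app (\<lambda>j. std_part (X $ j)) i)
      (app (\<lambda>j. dual_part (X $ j)) i + (\<Sum>j<n. D i j * std_part (X $ j)))"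
    if "X \<in> carrier_vec n" "i < n" for X i
    using mult_mat_vec_dual[OF A that] by (simp add: app_def B_def D_def)
  have bounds: "Min ((\<lambda>i. (A *\<^sub>v X) $ i / X $ i) ` {..<n}) \<le> lam \<and>
      lam \<le> Max ((\<lambda>i. (A *\<^sub>v X) $ i / X $ i) ` {..<n})"
    if X: "X \<in> carrier_vec n" "positive_dual_vec X" for X
  proof -
    define z where "z i = std_part (X $ i)" for i
    define w where "w i = dual_part (X $ i)" for i
    have Xpos: "0 < std_part (X $ i)" if "i < n" for i
      using X that by (auto simp: positive_dual_vec_def)
    have AX: "(A *\<^sub>v X) $ i = Dual (app z i) (app w i + (\<Sum>j<n. D i j * z j))" if "i < n" for i
      unfolding z_def w_def by (rule Ax[OF X(1) that])
    have lX: "lam * X $ i = Dual (rho * z i) (rho * w i + \<mu> * z i)" for i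
      by (simp add: dual_num_eq_iff lam z_def w_def)
    have gt: "lam < (A *\<^sub>v X) $ i / X $ i \<longleftrightarrow> rho * z i < app z i \<or> app z i = rho * z i \<and>
        rho * w i + \<mu> * z i < app w i + (\<Sum>j<n. D i j * z j)" if "i < n" for i
      unfolding less_divide_dual_iff(1)[OF Xpos[OF that]]
      unfolding AX[OF that] lX less_dual_num_def dual_num.sel by metis
    have lt: "(A *\<^sub>v X) $ i / X $ i < lam \<longleftrightarrow> app z i < rho * z i \<or> app z i = rho * z i \<and>
        app w i + (\<Sum>j<n. D i j * z j) < rho * w i + \<mu> * z i" if "i < n" for i
      unfolding less_divide_dual_iff(2)[OF Xpos[OF that]]
      unfolding AX[OF that] lX less_dual_num_def dual_num.sel by metis
    have "\<not> (\<forall>i<n. lam < (A *\<^sub>v X) $ i / X $ i)"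
    proof
      assume *: "\<forall>i<n. lam < (A *\<^sub>v X) $ i / X $ i"
      have less: "0 < 1 * (app z i - rho * z i) \<or> app z i = rho * z i \<and>
          0 < 1 * (app w i + (\<Sum>j<n. D i j * z j) - (rho * w i + \<mu> * z i))" if "i < n" for i
        using *[rule_format, OF that] unfolding gt[OF that] by auto
      show False by (rule no_uniformly_strict_bound[OF y x mu less])
    qed
    moreover have "\<not> (\<forall>i<n. (A *\<^sub>v X) $ i / X $ i < lam)"
    proof
      assume *: "\<forall>i<n. (A *\<^sub>v X) $ i / X $ i < lam"
      have less: "0 < - 1 * (app z i - rho * z i) \<or> app z i = rho * z i \<and>
          0 < - 1 * (app w i + (\<Sum>j<n. D i j * z j) - (rho * w i + \<mu> * z i))" if "i < n" for i
        using *[rule_format, OF that] unfolding lt[OF that] by auto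
      show False by (rule no_uniformly_strict_bound[OF y x mu less])
    qed
    ultimately show ?thesis
      using n by (simp add: Min_le_iff Max_ge_iff lessThan_empty_iff not_less Bex_def)
  qed
  define X where "X = vec n (\<lambda>i. Dual (x i) (v i))"
  have X: "X \<in> carrier_vec n" "positive_dual_vec X"
    using x(1) by (auto simp: X_def positive_dual_vec_def)
  have "(A *\<^sub>v X) $ i / X $ i = lam" if "i < n" for i
  proof -
    have "0 < std_part (X $ i)" using x(1) that by (simp add: X_def)
    moreover have "(A *\<^sub>v X) $ i = lam * X $ i"
      using that x(2) v'[OF that]
      unfolding Ax[OF X(1) that] dual_num_eq_iff by (simp add: lam X_def app_def)
    ultimately have "\<not> lam < (A *\<^sub>v X) $ i / X $ i" "\<not> (A *\<^sub>v X) $ i / X $ i < lam"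
      by (simp_all only: less_divide_dual_iff less_irrefl not_False_eq_True)
    then show ?thesis by simp
  qed
  then have const: "(\<lambda>i. (A *\<^sub>v X) $ i / X $ i) ` {..<n} = {lam}"
    using n by (auto simp: image_constant_conv cong: image_cong_simp)
  have "lam = Min ((\<lambda>i. (A *\<^sub>v X) $ i / X $ i) ` {..<n})"
    "lam = Max ((\<lambda>i. (A *\<^sub>v X) $ i / X $ i) ` {..<n})"
    unfolding const by simp_all
  then show ?thesis
    using bounds X unfolding is_maximum_def is_minimum_def by blast
qed

end
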